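(* Let $p$ be an odd prime, let $r\geq 1$ be an integer, and let $b_0,b_1,b_2,\ldots\in\mathbb{Q}_p$ be such that for all $n\geq0$: $v_p(b_{rn+1})<0$ and $v_p(b_{rn+i})=0$ for all $i\in\{2,\ldots,r\}$. Suppose moreover that for all $n\geq 0$: $v_p(U_{rn+2}^{(i)})=0$ for all $i\in\{2,\ldots,r-1\}$ (when $r\geq3$), and $v_p(U_{rn+3}^{(i)})=0$ for all $i\in\{2,\ldots,r-2\}$ (when $r\geq 4$). Define $B_0=1$, $B_1=b_1$, $B_n=b_nB_{n-1}+B_{n-2}$ for $n\ge2$. Then for all $n\geq0$, \[v_p(B_{rn+1})=v_p(B_{rn+2})=\cdots=v_p(B_{rn+r})>v_p(B_{rn+r+1}).\]
   Context: $v_p$ is the $p$-adic valuation. For integers $m\geq2$, the sequence $U_m^{(n)}$ is defined by $U_m^{(0)}=1$, $U_m^{(1)}=b_m$, $U_m^{(n+1)}=b_{m+n}U_m^{(n)}+U_m^{(n-1)}$ for $n\geq1$. The $B_n$ are the denominators of the convergents of the continued fraction $[b_0,b_1,b_2,\ldots]$. *)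

theory Defs
  imports
    "HOL-Library.Extended_Real"
    "HOL-Computational_Algebra.Fraction_Field"
    "Berlekamp_Zassenhaus.Finite_Field"
begin

text \<open>
  The prime is carried by a type variable of class \<open>prime_card\<close>: it is \<open>CARD('p)\<close>.
  A \<open>p\<close>-adic integer is an element of the inverse limit of the rings \<open>\<int>/p\<^sup>n\<int>\<close>, given by its
  residues in \<open>{0..<p\<^sup>n}\<close>; membership of that interval is implied by the compatibility condition.
\<close>

typedef (overloaded) ('p :: prime_card) padic_int =
  "{x :: nat \<Rightarrow> int. \<forall>n. x n = x (Suc n) mod int CARD('p) ^ n}"
  by (rule exI[of _ "\<lambda>_. 0"]) simp

setup_lifting type_definition_padic_int

lift_definition residue :: "'p :: prime_card padic_int \<Rightarrow> nat \<Rightarrow> int" is "\<lambda>x. x" .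

lemma card_pos: "0 < int CARD('p :: prime_card)"
  using prime_card[where 'a = 'p] prime_gt_0_nat by simp

lemma prime_int_card: "prime (int CARD('p :: prime_card))"
  using prime_card[where 'a = 'p] by simp

lemma mod_compat: "(a mod int CARD('p :: prime_card) ^ Suc n) mod int CARD('p) ^ n =
    a mod int CARD('p) ^ n"
  by (intro mod_mod_cancel le_imp_power_dvd) simp

instantiation padic_int :: (prime_card) comm_ring_1
begin

lift_definition zero_padic_int :: "'a padic_int" is "\<lambda>_. 0" by simp

lift_definition one_padic_int :: "'a padic_int" is "\<lambda>n. 1 mod int CARD('a) ^ n"
  by (subst mod_compat) (rule refl)

lift_definition plus_padic_int :: "'a padic_int \<Rightarrow> 'a padic_int \<Rightarrow> 'a padic_int"
  is "\<lambda>x y n. (x n + y n) mod int CARD('a) ^ n"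
  by (subst mod_compat) (metis mod_add_eq)

lift_definition uminus_padic_int :: "'a padic_int \<Rightarrow> 'a padic_int"
  is "\<lambda>x n. (- x n) mod int CARD('a) ^ n"
  by (subst mod_compat) (metis mod_minus_eq)

lift_definition minus_padic_int :: "'a padic_int \<Rightarrow> 'a padic_int \<Rightarrow> 'a padic_int"
  is "\<lambda>x y n. (x n - y n) mod int CARD('a) ^ n"
  by (subst mod_compat) (metis mod_diff_eq)

lift_definition times_padic_int :: "'a padic_int \<Rightarrow> 'a padic_int \<Rightarrow> 'a padic_int"
  is "\<lambda>x y n. (x n * y n) mod int CARD('a) ^ n"
  by (subst mod_compat) (metis mod_mult_eq)

lemma residue_eqI: "(\<And>n. residue x n = residue y n) \<Longrightarrow> x = y"
  by (simp add: residue.rep_eq flip: Rep_padic_int_inject) (rule ext)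

lemma residue_0 [simp]: "residue 0 n = 0"
  by (simp add: residue.rep_eq zero_padic_int.rep_eq)

lemma residue_1: "residue (1 :: 'a padic_int) n = 1 mod int CARD('a) ^ n"
  by (simp add: residue.rep_eq one_padic_int.rep_eq)

lemma residue_add: "residue (x + y :: 'a padic_int) n =
    (residue x n + residue y n) mod int CARD('a) ^ n"
  by (simp add: residue.rep_eq plus_padic_int.rep_eq)

lemma residue_uminus: "residue (- x :: 'a padic_int) n = (- residue x n) mod int CARD('a) ^ n"
  by (simp add: residue.rep_eq uminus_padic_int.rep_eq)

lemma residue_diff: "residue (x - y :: 'a padic_int) n =
    (residue x n - residue y n) mod int CARD('a) ^ n"
  by (simp add: residue.rep_eq minus_padic_int.rep_eq)

lemma residue_mult: "residue (x * y :: 'a padic_int) n =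
    (residue x n * residue y n) mod int CARD('a) ^ n"
  by (simp add: residue.rep_eq times_padic_int.rep_eq)

lemma residue_Suc: "residue (x :: 'a padic_int) (Suc n) mod int CARD('a) ^ n = residue x n"
  unfolding residue.rep_eq by (rule sym, rule spec[OF CollectD[OF Rep_padic_int[of x]]])

lemma residue_mod_self: "residue (x :: 'a padic_int) n mod int CARD('a) ^ n = residue x n"
  by (subst (1 2) residue_Suc[of x n, symmetric]) (rule mod_mod_trivial)

instance
proof
  fix a b c :: "'a padic_int"
  show "a + b + c = a + (b + c)"
    by (rule residue_eqI) (simp add: residue_add mod_simps ac_simps)
  show "a + b = b + a"
    by (rule residue_eqI) (simp add: residue_add ac_simps)
  show "0 + a = a"
    by (rule residue_eqI) (simp add: residue_add residue_mod_self)
  show "- a + a = 0"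
    by (rule residue_eqI) (simp add: residue_add residue_uminus mod_simps)
  show "a - b = a + - b"
    by (rule residue_eqI) (simp add: residue_add residue_uminus residue_diff mod_simps)
  show "a * b * c = a * (b * c)"
    by (rule residue_eqI) (simp add: residue_mult mod_simps ac_simps)
  show "a * b = b * a"
    by (rule residue_eqI) (simp add: residue_mult ac_simps)
  show "1 * a = a"
    by (rule residue_eqI) (simp add: residue_mult residue_1 mod_simps residue_mod_self)
  show "(a + b) * c = a * c + b * c"
    by (rule residue_eqI) (simp add: residue_add residue_mult mod_simps algebra_simps)
  have "residue (1 :: 'a padic_int) 1 \<noteq> residue 0 1"
    using prime_gt_1_nat[OF prime_card[where 'a = 'a]] by (simp add: residue_1)
  then show "(0 :: 'a padic_int) \<noteq> 1" by (rule contrapos_nn) (rule arg_cong2[where f = residue], simp_all)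
qed

end

lemma residue_mod: "m \<le> n \<Longrightarrow>
    residue (x :: 'p :: prime_card padic_int) n mod int CARD('p) ^ m = residue x m"
proof (induction n)
  case 0
  then show ?case using residue_Suc[of x 0] by simp
next
  case (Suc n)
  show ?case
  proof (cases "m = Suc n")
    case True
    then show ?thesis by (simp only: residue_mod_self)
  next
    case False
    then have "m \<le> n" using Suc.prems by simp
    then have "residue x (Suc n) mod int CARD('p) ^ m =
        residue x (Suc n) mod int CARD('p) ^ n mod int CARD('p) ^ m"
      by (simp add: mod_mod_cancel le_imp_power_dvd)
    then show ?thesis using Suc.IH \<open>m \<le> n\<close> by (simp add: residue_Suc)
  qed
qed

lemma residue_eq_0_iff: "m \<le> n \<Longrightarrow>
    residue (x :: 'p :: prime_card padic_int) m = 0 \<longleftrightarrow> int CARD('p) ^ m dvd residue x n"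
  using residue_mod[of m n x] by (simp add: dvd_eq_mod_eq_0)

lemma residue_mult_eq_0:
  fixes x y :: "'p :: prime_card padic_int"
  assumes "residue (x * y) n = 0"
  obtains i j where "i + j = n" "residue x i = 0" "residue y j = 0"
proof -
  have "int CARD('p) ^ n dvd residue x n * residue y n"
    using assms by (simp add: residue_mult dvd_eq_mod_eq_0)
  from prime_elem_power_dvd_prod[OF this] prime_int_card[where 'p = 'p]
  obtain i j where ij: "i + j = n"
      "int CARD('p) ^ i dvd residue x n" "int CARD('p) ^ j dvd residue y n"
    by blast
  have "residue x i = 0" using ij residue_eq_0_iff[of i n x] by simp
  moreover have "residue y j = 0" using ij residue_eq_0_iff[of j n y] by simp
  ultimately show ?thesis using that ij(1) by blast
qed

lemma residue_0_mono: "residue x n = 0 \<Longrightarrow> m \<le> n \<Longrightarrow> residue x m = 0"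
  using residue_mod[of m n x] by simp

instance padic_int :: (prime_card) idom
proof
  fix x y :: "'a padic_int"
  assume "x \<noteq> 0" "y \<noteq> 0"
  then obtain m k where mk: "residue x m \<noteq> 0" "residue y k \<noteq> 0"
    by (metis residue_0 residue_eqI)
  show "x * y \<noteq> 0"
  proof
    assume "x * y = 0"
    then have "residue (x * y) (m + k) = 0" by simp
    then obtain i j where ij: "i + j = m + k" "residue x i = 0" "residue y j = 0"
      by (rule residue_mult_eq_0)
    then have "\<not> m \<le> i" "\<not> k \<le> j" using mk residue_0_mono by blast+
    then show False using ij(1) by simp
  qed
qed

type_synonym 'p padic = "'p padic_int fract"

text \<open>Unspecified at \<open>0\<close>, where \<open>GREATEST\<close> has no witness.\<close>

definition padic_int_ord :: "'p :: prime_card padic_int \<Rightarrow> nat" where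
  "padic_int_ord x = (GREATEST k. of_nat CARD('p) ^ k dvd x)"

definition padic_val :: "'p :: prime_card padic \<Rightarrow> ereal" where
  "padic_val q = (if q = 0 then \<infinity> else
     (THE e. \<exists>x y. x \<noteq> 0 \<and> y \<noteq> 0 \<and> q = Fract x y \<and>
        e = ereal (real (padic_int_ord x) - real (padic_int_ord y))))"

lemma residue_of_nat: "residue (of_nat a :: 'p :: prime_card padic_int) n = int a mod int CARD('p) ^ n"
proof (induction a)
  case (Suc a)
  then show ?case by (simp add: residue_add residue_1 mod_simps)
qed simp

lemma power_dvd_iff_residue:
  fixes x :: "'p :: prime_card padic_int"
  shows "of_nat CARD('p) ^ k dvd x \<longleftrightarrow> residue x k = 0"
proof
  have *: "residue (of_nat CARD('p) ^ k :: 'p padic_int) n = int CARD('p) ^ k mod int CARD('p) ^ n" for n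
    using residue_of_nat[of "CARD('p) ^ k" n, where 'p = 'p] by simp
  show "residue x k = 0" if "of_nat CARD('p) ^ k dvd x"
    using that * by (auto simp: dvd_def residue_mult)
  assume x: "residue x k = 0"
  define y where "y = (\<lambda>n. residue x (n + k) div int CARD('p) ^ k)"
  have d: "int CARD('p) ^ k dvd residue x (n + k)" for n
    using residue_eq_0_iff[of k "n + k" x] x by simp
  have y: "residue x (n + k) = int CARD('p) ^ k * y n" for n
    using d by (simp add: y_def)
  have "y n = y (Suc n) mod int CARD('p) ^ n" for n
  proof -
    have "int CARD('p) ^ k * y n = (int CARD('p) ^ k * y (Suc n)) mod int CARD('p) ^ (n + k)"
      using residue_Suc[of x "n + k"] y[of n] y[of "Suc n"] by simp
    also have "\<dots> = int CARD('p) ^ k * (y (Suc n) mod int CARD('p) ^ n)"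
      by (simp only: mult_mod_right power_add mult.commute[of "int CARD('p) ^ n"])
    finally show ?thesis using card_pos[where 'p = 'p] by simp
  qed
  then have "y \<in> {x. \<forall>n. x n = x (Suc n) mod int CARD('p) ^ n}" by blast
  then obtain z :: "'p padic_int" where z: "residue z = y"
    by (metis (no_types) Abs_padic_int_inverse residue.rep_eq)
  have "x = of_nat CARD('p) ^ k * z"
  proof (rule residue_eqI)
    fix n
    have "residue x n = residue x (n + k) mod int CARD('p) ^ n" by (simp add: residue_mod)
    also have "\<dots> = (int CARD('p) ^ k * residue z n) mod int CARD('p) ^ n"
      by (simp add: y z)
    finally show "residue x n = residue (of_nat CARD('p) ^ k * z) n"
      by (simp add: residue_mult * mod_simps)
  qed
  then show "of_nat CARD('p) ^ k dvd x" by simp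
qed

lemma padic_int_ord_ge_iff:
  fixes x :: "'p :: prime_card padic_int"
  assumes "x \<noteq> 0"
  shows "k \<le> padic_int_ord x \<longleftrightarrow> residue x k = 0"
proof -
  obtain m where m: "residue x m \<noteq> 0" using assms by (metis residue_0 residue_eqI)
  have b: "j \<le> m" if "residue x j = 0" for j
    using m that residue_0_mono[of x j m] by (metis nle_le)
  have 0: "residue x 0 = 0" using residue_mod[of 0 0 x] by simp
  have o: "padic_int_ord x = (GREATEST k. residue x k = 0)"
    by (simp add: padic_int_ord_def power_dvd_iff_residue)
  have "residue x (padic_int_ord x) = 0"
    unfolding o by (rule GreatestI_nat[where P = "\<lambda>k. residue x k = 0", OF 0 b])
  moreover have "j \<le> padic_int_ord x" if "residue x j = 0" for j
    unfolding o by (rule Greatest_le_nat[where P = "\<lambda>k. residue x k = 0", OF that b])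
  ultimately show ?thesis using residue_0_mono by blast
qed

lemma padic_int_ord_mult:
  fixes x y :: "'p :: prime_card padic_int"
  assumes "x \<noteq> 0" "y \<noteq> 0"
  shows "padic_int_ord (x * y) = padic_int_ord x + padic_int_ord y"
proof (rule antisym)
  let ?a = "padic_int_ord x" and ?b = "padic_int_ord y"
  have xy: "x * y \<noteq> 0" using assms by simp
  have "of_nat CARD('p) ^ ?a dvd x" "of_nat CARD('p) ^ ?b dvd y"
    using assms padic_int_ord_ge_iff by (auto simp: power_dvd_iff_residue)
  then have "of_nat CARD('p) ^ (?a + ?b) dvd x * y"
    by (simp add: power_add mult_dvd_mono)
  then show "?a + ?b \<le> padic_int_ord (x * y)"
    using padic_int_ord_ge_iff[OF xy] by (simp add: power_dvd_iff_residue)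
  show "padic_int_ord (x * y) \<le> ?a + ?b"
  proof (rule ccontr)
    assume "\<not> ?thesis"
    then have "residue (x * y) (Suc (?a + ?b)) = 0"
      using padic_int_ord_ge_iff[OF xy, of "Suc (?a + ?b)"] by simp
    then obtain i j where ij: "i + j = Suc (?a + ?b)" "residue x i = 0" "residue y j = 0"
      by (rule residue_mult_eq_0)
    then have "i \<le> ?a" "j \<le> ?b" using assms padic_int_ord_ge_iff by auto
    then show False using ij(1) by simp
  qed
qed

lemma padic_val_0 [simp]: "padic_val 0 = \<infinity>"
  by (simp add: padic_val_def)

lemma padic_val_Fract:
  fixes x y :: "'p :: prime_card padic_int"
  assumes "x \<noteq> 0" "y \<noteq> 0"
  shows "padic_val (Fract x y) = ereal (real (padic_int_ord x) - real (padic_int_ord y))"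
proof -
  have "Fract x y \<noteq> 0" using assms by (simp add: Zero_fract_def eq_fract)
  moreover have "(THE e. \<exists>u v. u \<noteq> 0 \<and> v \<noteq> 0 \<and> Fract x y = Fract u v \<and>
        e = ereal (real (padic_int_ord u) - real (padic_int_ord v))) =
      ereal (real (padic_int_ord x) - real (padic_int_ord y))"
  proof (rule the_equality)
    fix e assume "\<exists>u v. u \<noteq> 0 \<and> v \<noteq> 0 \<and> Fract x y = Fract u v \<and>
        e = ereal (real (padic_int_ord u) - real (padic_int_ord v))"
    then obtain u v where uv: "u \<noteq> 0" "v \<noteq> 0" "Fract x y = Fract u v"
        and e: "e = ereal (real (padic_int_ord u) - real (padic_int_ord v))" by blast
    have "x * v = u * y" using uv assms by (simp add: eq_fract)
    then have "padic_int_ord x + padic_int_ord v = padic_int_ord u + padic_int_ord y"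
      using uv assms by (metis padic_int_ord_mult)
    then have "real (padic_int_ord x) + real (padic_int_ord v) =
        real (padic_int_ord u) + real (padic_int_ord y)" by (metis of_nat_add)
    then show "e = ereal (real (padic_int_ord x) - real (padic_int_ord y))"
      using e by simp
  qed (use assms in blast)
  ultimately show ?thesis by (simp add: padic_val_def)
qed

lemma padic_val_mult: "padic_val (a * b) = padic_val a + padic_val b"
proof (cases "a = 0 \<or> b = 0")
  case True
  then show ?thesis by (auto simp: padic_val_def)
next
  case False
  obtain x y where a: "a = Fract x y" "y \<noteq> 0" by (cases a)
  obtain u v where b: "b = Fract u v" "v \<noteq> 0" by (cases b)
  have "x \<noteq> 0" "u \<noteq> 0" using a b False by (auto simp: fract_collapse)
  then show ?thesis using a b by (simp add: padic_val_Fract padic_int_ord_mult)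
qed

lemma padic_val_prime: "padic_val (of_nat CARD('p) :: 'p :: prime_card padic) = 1"
proof -
  let ?p = "of_nat CARD('p) :: 'p padic_int"
  have r: "residue ?p k = int CARD('p) mod int CARD('p) ^ k" for k
    by (rule residue_of_nat)
  have "int CARD('p) < int CARD('p) ^ 2"
    using prime_gt_1_nat[OF prime_card[where 'a = 'p]] by (simp add: power2_eq_square)
  then have r2: "residue ?p 2 \<noteq> 0" using card_pos[where 'p = 'p] by (simp add: r)
  then have nz: "?p \<noteq> 0" by (metis residue_0)
  have "residue ?p 1 = 0" by (simp add: r)
  then have "1 \<le> padic_int_ord ?p" "\<not> 2 \<le> padic_int_ord ?p"
    using r2 by (simp_all only: padic_int_ord_ge_iff[OF nz] simp_thms)
  then have "padic_int_ord ?p = 1" by simp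
  moreover have "padic_int_ord (1 :: 'p padic_int) = 0"
    using padic_int_ord_mult[of "1 :: 'p padic_int" 1] by simp
  moreover have "(of_nat n :: 'p padic) = Fract (of_nat n) 1" for n
    by (rule of_nat_fract)
  ultimately show ?thesis using nz by (simp add: padic_val_Fract)
qed

lemma padic_int_ord_add:
  assumes "x \<noteq> 0" "y \<noteq> 0" "x + y \<noteq> 0"
  shows "min (padic_int_ord x) (padic_int_ord y) \<le> padic_int_ord (x + y)"
proof -
  let ?k = "min (padic_int_ord x) (padic_int_ord y)"
  have "residue x ?k = 0" "residue y ?k = 0"
    using padic_int_ord_ge_iff[OF assms(1), of ?k] padic_int_ord_ge_iff[OF assms(2), of ?k] by simp_all
  then have "residue (x + y) ?k = 0" by (simp add: residue_add)
  then show ?thesis using padic_int_ord_ge_iff[OF assms(3)] by blast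
qed

lemma padic_val_add: "min (padic_val a) (padic_val b) \<le> padic_val (a + b)"
proof (cases "a = 0 \<or> b = 0 \<or> a + b = 0")
  case True
  then show ?thesis by auto
next
  case False
  obtain x y where a: "a = Fract x y" "y \<noteq> 0" by (cases a)
  obtain u v where b: "b = Fract u v" "v \<noteq> 0" by (cases b)
  have nz: "x \<noteq> 0" "u \<noteq> 0" using a b False by (auto simp: fract_collapse)
  have ab: "a + b = Fract (x * v + u * y) (y * v)" using a b by simp
  then have s: "x * v + u * y \<noteq> 0" using False by (auto simp: fract_collapse)
  have "min (padic_int_ord (x * v)) (padic_int_ord (u * y)) \<le> padic_int_ord (x * v + u * y)"
    using nz a b s by (intro padic_int_ord_add) auto
  then have "padic_int_ord x + padic_int_ord v \<le> padic_int_ord (x * v + u * y) \<or>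
      padic_int_ord u + padic_int_ord y \<le> padic_int_ord (x * v + u * y)"
    using nz a b by (simp add: padic_int_ord_mult min_le_iff_disj)
  then show ?thesis unfolding ab unfolding a b
    using nz s a b by (auto simp: padic_val_Fract padic_int_ord_mult min_le_iff_disj)
qed

fun cf_denom :: "(nat \<Rightarrow> 'a :: comm_ring_1) \<Rightarrow> nat \<Rightarrow> 'a" where
  "cf_denom b 0 = 1"
| "cf_denom b (Suc 0) = b 1"
| "cf_denom b (Suc (Suc n)) = b (Suc (Suc n)) * cf_denom b (Suc n) + cf_denom b n"

text \<open>\<open>cf_U b m n\<close> is \<open>U\<close> with lower index \<open>m\<close> and upper index \<open>n\<close>.\<close>

fun cf_U :: "(nat \<Rightarrow> 'a :: comm_ring_1) \<Rightarrow> nat \<Rightarrow> nat \<Rightarrow> 'a" where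
  "cf_U b m 0 = 1"
| "cf_U b m (Suc 0) = b m"
| "cf_U b m (Suc (Suc n)) = b (m + Suc n) * cf_U b m (Suc n) + cf_U b m n"

end

theory Submission
  imports Defs
begin

text \<open>
  Unrolling the recurrence from index \<open>m = r n\<close> gives
  \<open>B\<^bsub>m+1+i\<^esub> = U\<^bsub>m+2\<^esub>\<^bsup>(i)\<^esup> B\<^bsub>m+1\<^esub> + U\<^bsub>m+3\<^esub>\<^bsup>(i-1)\<^esup> B\<^bsub>m\<^esub>\<close>.
  If \<open>v(B\<^bsub>m+1\<^esub>) < v(B\<^bsub>m\<^esub>)\<close>, the first summand dominates for \<open>1 \<le> i \<le> r - 1\<close>, since its
  coefficient is a unit and the other one is integral; so the valuation stays constant on the
  block. The next partial quotient has negative valuation, which makes the valuation drop again at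
  \<open>m + r + 1\<close> and provides the hypothesis for the next block.
\<close>

text \<open>With the next lemma, this makes the value of a nonzero element a real number, so that
  sums of values can be cancelled.\<close>

lemma padic_val_neq_MInfty [simp]: "padic_val a \<noteq> - \<infinity>"
proof (cases "a = 0")
  case False
  obtain x y where a: "a = Fract x y" "y \<noteq> 0" by (cases a)
  then have "x \<noteq> 0" using False by (auto simp: fract_collapse)
  then show ?thesis using a by (simp add: padic_val_Fract)
qed simp

lemma padic_val_eq_PInfty_iff [simp]: "padic_val a = \<infinity> \<longleftrightarrow> a = 0"
proof (cases "a = 0")
  case False
  obtain x y where a: "a = Fract x y" "y \<noteq> 0" by (cases a)
  then have "x \<noteq> 0" using False by (auto simp: fract_collapse)
  then show ?thesis using a False by (simp add: padic_val_Fract)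
qed simp

lemma padic_val_1 [simp]: "padic_val (1 :: 'p :: prime_card padic) = 0"
proof -
  have "padic_val (1 :: 'p padic) \<noteq> \<infinity>" by simp
  with padic_val_mult[of "1 :: 'p padic" 1] padic_val_neq_MInfty[of "1 :: 'p padic"]
  show ?thesis by (cases "padic_val (1 :: 'p padic)") auto
qed

lemma padic_val_minus [simp]: "padic_val (- a) = padic_val (a :: 'p :: prime_card padic)"
proof -
  \<comment> \<open>Since \<open>(- 1) * (- 1) = 1\<close>, twice the finite value of
    \<open>- 1\<close> is 0.\<close>
  have "padic_val (- 1 :: 'p padic) \<noteq> \<infinity>" by simp
  with padic_val_mult[of "- 1 :: 'p padic" "- 1"] padic_val_neq_MInfty[of "- 1 :: 'p padic"]
  have "padic_val (- 1 :: 'p padic) = 0" by (cases "padic_val (- 1 :: 'p padic)") auto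
  then show ?thesis using padic_val_mult[of "- 1" a] by simp
qed

lemma padic_val_add_dominant:
  assumes "padic_val a < padic_val c"
  shows "padic_val (a + c) = padic_val a"
proof (rule antisym)
  show "padic_val a \<le> padic_val (a + c)"
    using padic_val_add[of a c] assms by (simp add: min_absorb1)
  \<comment> \<open>Recover \<open>a\<close> as \<open>(a + c) + (- c)\<close>; as \<open>c\<close>
    has larger value than \<open>a\<close>, the minimum must come from \<open>a + c\<close>.\<close>
  have "min (padic_val (a + c)) (padic_val c) \<le> padic_val a"
    using padic_val_add[of "a + c" "- c"] by simp
  then show "padic_val (a + c) \<le> padic_val a"
    using assms by (auto simp: min_le_iff_disj)
qed

text \<open>For fixed \<open>m\<close> both sides obey the same three-term recurrence in
  \<open>i\<close>, so two initial cases suffice. Starting at \<open>m + 2\<close> avoids a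
  subtraction in the upper index of the second coefficient.\<close>

lemma cf_denom_eq_cf_U:
  "cf_denom b (m + 2 + i) = cf_U b (m + 2) (Suc i) * cf_denom b (m + 1) + cf_U b (m + 3) i * cf_denom b m"
proof (induction i rule: induct_nat_012)
  case (ge2 i)
  have "cf_denom b (m + 2 + Suc (Suc i)) =
      b (m + 2 + Suc (Suc i)) * cf_denom b (m + 2 + Suc i) + cf_denom b (m + 2 + i)"
    by simp
  then show ?case
    unfolding ge2 by (simp add: algebra_simps numeral_3_eq_3)
qed (simp_all add: algebra_simps numeral_3_eq_3)

lemma padic_val_cf_denom_block:
  fixes b :: "nat \<Rightarrow> 'p :: prime_card padic"
  assumes drop: "padic_val (cf_denom b (m + 1)) < padic_val (cf_denom b m)"
    and "padic_val (cf_U b (m + 2) (Suc i)) = 0"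
    and "padic_val (cf_U b (m + 3) i) \<ge> 0"
  shows "padic_val (cf_denom b (m + 2 + i)) = padic_val (cf_denom b (m + 1))"
proof -
  have "padic_val (cf_denom b m) \<le> padic_val (cf_U b (m + 3) i * cf_denom b m)"
    using assms(3) add_right_mono[of 0 "padic_val (cf_U b (m + 3) i)"]
    by (fastforce simp: padic_val_mult)
  with drop have "padic_val (cf_U b (m + 2) (Suc i) * cf_denom b (m + 1))
      < padic_val (cf_U b (m + 3) i * cf_denom b m)"
    unfolding padic_val_mult[of "cf_U b (m + 2) (Suc i)"] assms(2) by simp
  from padic_val_add_dominant[OF this] show ?thesis
    unfolding cf_denom_eq_cf_U padic_val_mult assms(2) by simp
qed

text \<open>The product term has value strictly below that of \<open>cf_denom b (Suc k)\<close>,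
  which is finite by \<open>nz\<close>, and hence dominates \<open>cf_denom b k\<close>.\<close>

lemma padic_val_cf_denom_drop:
  fixes b :: "nat \<Rightarrow> 'p :: prime_card padic"
  assumes neg: "padic_val (b (Suc (Suc k))) < 0"
    and nz: "cf_denom b (Suc k) \<noteq> 0"
    and le: "padic_val (cf_denom b (Suc k)) \<le> padic_val (cf_denom b k)"
  shows "padic_val (cf_denom b (Suc (Suc k))) < padic_val (cf_denom b (Suc k))"
proof -
  have less: "padic_val (b (Suc (Suc k)) * cf_denom b (Suc k)) < padic_val (cf_denom b (Suc k))"
    using neg nz padic_val_neq_MInfty[of "cf_denom b (Suc k)"]
      padic_val_eq_PInfty_iff[of "cf_denom b (Suc k)"]
    by (cases "padic_val (b (Suc (Suc k)))"; cases "padic_val (cf_denom b (Suc k))")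
      (auto simp: padic_val_mult)
  then show ?thesis
    using padic_val_add_dominant[OF less_le_trans[OF less le]] by simp
qed

theorem theorem6p3:
  fixes b :: "nat \<Rightarrow> 'p :: prime_card padic" and r :: nat
  assumes "odd CARD('p)"
    and "r \<ge> 1"
    and "\<And>n. padic_val (b (r * n + 1)) < 0"
    and "\<And>n i. i \<in> {2..r} \<Longrightarrow> padic_val (b (r * n + i)) = 0"
    and "\<And>n i. r \<ge> 3 \<Longrightarrow> i \<in> {2..r - 1} \<Longrightarrow> padic_val (cf_U b (r * n + 2) i) = 0"
    and "\<And>n i. r \<ge> 4 \<Longrightarrow> i \<in> {2..r - 2} \<Longrightarrow> padic_val (cf_U b (r * n + 3) i) = 0"
  shows "\<forall>n. (\<forall>i\<in>{1..r}. padic_val (cf_denom b (r * n + i)) = padic_val (cf_denom b (r * n + 1)))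
           \<and> padic_val (cf_denom b (r * n + r)) > padic_val (cf_denom b (r * n + r + 1))"
proof -
  have block: "padic_val (cf_denom b (r * n + i)) = padic_val (cf_denom b (r * n + 1))"
    if drop: "padic_val (cf_denom b (r * n + 1)) < padic_val (cf_denom b (r * n))"
      and i: "i \<in> {1..r}" for n i
  proof (cases "i = 1")
    case False
    with i obtain j where j: "i = 2 + j" and r: "2 + j \<le> r"
      by (metis atLeastAtMost_iff add.commute le_add_diff_inverse2 le_antisym not_less_eq_eq
          numeral_2_eq_2 One_nat_def)
    \<comment> \<open>For \<open>j = 0\<close> this is the partial quotient at
      \<open>r * n + 2\<close>; otherwise \<open>Suc j\<close> lies in
      \<open>{2..r - 1}\<close>.\<close>
    have "padic_val (cf_U b (r * n + 2) (Suc j)) = 0"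
      using assms(4)[of 2 n] assms(5)[of "Suc j" n] r by (cases j) auto
    moreover have "padic_val (cf_U b (r * n + 3) j) = 0"
    proof -
      \<comment> \<open>The upper indices 0 and 1 give 1 and the unit at
        \<open>r * n + 3\<close>.\<close>
      consider "j = 0" | "j = 1" | "2 \<le> j" by linarith
      then show ?thesis
        using assms(4)[of 3 n] assms(6)[of j n] r by cases auto
    qed
    ultimately show ?thesis
      using padic_val_cf_denom_block[OF drop, of j] j by (simp add: add.assoc)
  qed simp
  have next_drop: "padic_val (cf_denom b (r * n + r + 1)) < padic_val (cf_denom b (r * n + r))"
    if drop: "padic_val (cf_denom b (r * n + 1)) < padic_val (cf_denom b (r * n))" for n
  proof -
    obtain s where s: "r = Suc s" using assms(2) by (cases r) auto
    have last: "padic_val (cf_denom b (r * n + r)) = padic_val (cf_denom b (r * n + 1))"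
      using block[OF drop, of r] assms(2) by simp
    \<comment> \<open>If \<open>s = 0\<close>, the block has length 1 and the preceding index lies
      outside it, so \<open>drop\<close> applies; otherwise both indices lie in the block and
      equality holds.\<close>
    have "padic_val (cf_denom b (r * n + r)) \<le> padic_val (cf_denom b (r * n + s))"
      using last drop block[OF drop, of s] s by (cases "s = 0") auto
    moreover have "cf_denom b (r * n + r) \<noteq> 0"
      using drop unfolding last[symmetric] by auto
    moreover have "padic_val (b (r * n + r + 1)) < 0"
      using assms(3)[of "Suc n"] by (simp add: add.commute)
    ultimately show ?thesis
      using padic_val_cf_denom_drop[of b "r * n + s"] s by simp
  qed
  have drop: "padic_val (cf_denom b (r * n + 1)) < padic_val (cf_denom b (r * n))" for n
  proof (induction n)
    case 0
    \<comment> \<open>Here \<open>cf_denom b 0 = 1\<close> has value 0 and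
      \<open>cf_denom b 1 = b 1\<close> has negative value.\<close>
    then show ?case using assms(3)[of 0] by simp
  next
    case (Suc n)
    then show ?case using next_drop[of n] by (simp add: add.commute)
  qed
  show ?thesis using block[OF drop] next_drop[OF drop] by blast
qed

end
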